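(* Let $\{X_{n,k}, \, 1 \leqslant k \leqslant n, n \geqslant 1\}$ be an array of random variables satisfying $\mathbb{E}|X_{n,k}| < \infty$ for each $1 \leqslant k \leqslant n$ and all $n \geqslant 1$. Suppose that for some $q > 1$ and some sequence $\{\alpha_{n}\}$ of positive numbers, $$\mathbb{E}\left|\sum_{k=1}^{n}\left[g_{t}(X_{n,k}) - \mathbb{E}\, g_{t}(X_{n,k})\right]\right|^{q} \leqslant \alpha_{n}\sum_{k=1}^{n}\mathbb{E}\,|g_{t}(X_{n,k})|^{q}\quad\text{for all } n \geqslant 1 \text{ and } t > 0.$$ If $\{b_{n}\}$, $\{c_{n}\}$ are real sequences of positive numbers such that (a) $\sum_{n=1}^{\infty}\sum_{k=1}^{n}\alpha_{n}c_{n}b_{n}^{-q}\int_{0}^{b_{n}^{q}}\mathbb{P}\{|X_{n,k}|^{q} > t\}\,\mathrm{d}t < \infty$, (b) $\sum_{n=1}^{\infty}\sum_{k=1}^{n}c_{n}\,\mathbb{E}\left[|X_{n,k}| I_{\{|X_{n,k}| > b_{n}\}}\right]/b_{n} < \infty$, (c) $\sum_{n=1}^{\infty}\sum_{k=1}^{n}(\alpha_{n}c_{n}/b_{n})\int_{b_{n}}^{\infty}\mathbb{P}\{|X_{n,k}| > t\}\,\mathrm{d}t < \infty$, then $$\sum_{n=1}^{\infty}c_{n}\,\mathbb{E}\left[\frac{\left|\sum_{k=1}^{n}(X_{n,k} - \mathbb{E}\,X_{n,k})\right|}{b_{n}} - \varepsilon\right]_{+} < \infty$$ for all $\varepsilon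 > 0$.
   Context: Notation: $x_{+} = \max(x,0)$. $I_{A}$ is the indicator random variable of the event $A$. For $t>0$, $g_{t}(x) = \max(\min(x,t),-t)$ is truncation at level $t$. *)

theory Defs
  imports "HOL-Probability.Probability"
begin

definition trunc :: "real \<Rightarrow> real \<Rightarrow> real" where
  "trunc t x = max (min x t) (- t)"

definition pos_part :: "real \<Rightarrow> real" where
  "pos_part x = max x 0"

end

theory Submission
  imports Defs
begin

text \<open>
  Truncate at the level \<open>b n\<close> itself. The part above the level contributes at most twice the
  \<open>n\<close>-th term of the series (b). For the truncated part, \<open>y \<ge> \<epsilon>\<close> gives
  \<open>y = y powr q * y powr (1 - q) \<le> \<epsilon> powr (1 - q) * y powr q\<close>, so the moment inequality at
  \<open>t = b n\<close> applies, and by the layer cake formula its right-hand side is a constant multiple of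
  the \<open>n\<close>-th term of the series (a).
\<close>

text \<open>Layer cake with a cut-off: \<open>min (Y \<omega>) B\<close> is the length of the set of
  \<open>t\<close> in \<open>{0..B}\<close> with \<open>t < Y \<omega>\<close>, and Tonelli
  exchanges the integrals over \<open>t\<close> and \<open>\<omega>\<close>. It converts the
  integrals in series (a) into truncated moments.\<close>

lemma (in prob_space) expectation_min_eq_integral_tail:
  fixes Y :: "'a \<Rightarrow> real"
  assumes Y [measurable]: "Y \<in> borel_measurable M"
    and nonneg: "\<And>\<omega>. Y \<omega> \<ge> 0" and "B \<ge> 0"
  shows "(LBINT t:{0..B}. \<P>(\<omega> in M. Y \<omega> > t)) = expectation (\<lambda>\<omega>. min (Y \<omega>) B)"
proof -
  have m: "(\<lambda>t. measure M {\<omega> \<in> space M. Y \<omega> > t}) \<in> borel_measurable lborel"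
    by measurable
  have "(\<integral>\<^sup>+ t. ennreal (indicator {0..B} t * \<P>(\<omega> in M. Y \<omega> > t)) \<partial>lborel)
      = (\<integral>\<^sup>+ t. (\<integral>\<^sup>+ \<omega>. indicator {0..B} t * indicator {\<omega> \<in> space M. Y \<omega> > t} \<omega> \<partial>M) \<partial>lborel)"
    by (intro nn_integral_cong)
      (simp add: nn_integral_cmult emeasure_eq_measure ennreal_mult ennreal_indicator)
  also have "\<dots> = (\<integral>\<^sup>+ t. (\<integral>\<^sup>+ \<omega>. (if 0 \<le> t \<and> t \<le> B \<and> t < Y \<omega> then 1 else 0) \<partial>M) \<partial>lborel)"
    by (intro nn_integral_cong) (auto split: split_indicator)
  also have "\<dots> = (\<integral>\<^sup>+ \<omega>. (\<integral>\<^sup>+ t. (if 0 \<le> t \<and> t \<le> B \<and> t < Y \<omega> then 1 else 0) \<partial>lborel) \<partial>M)"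
    by (rule pair_sigma_finite.Fubini') (auto intro!: pair_sigma_finite.intro
        sigma_finite_measure_axioms lborel.sigma_finite_measure_axioms)
  also have "\<dots> = (\<integral>\<^sup>+ \<omega>. ennreal (min (Y \<omega>) B) \<partial>M)"
  proof (intro nn_integral_cong)
    \<comment> \<open>The strict inequality \<open>t < Y \<omega>\<close> makes the section
      half-open when \<open>Y \<omega> \<le> B\<close>; otherwise the section is all of
      \<open>{0..B}\<close>. Its length is the minimum in both cases.\<close>
    fix \<omega>
    have "(\<integral>\<^sup>+ t. (if 0 \<le> t \<and> t \<le> B \<and> t < Y \<omega> then 1 else 0) \<partial>lborel)
        = (\<integral>\<^sup>+ t. indicator (if Y \<omega> \<le> B then {0..<Y \<omega>} else {0..B}) t \<partial>lborel)"
      by (intro nn_integral_cong) (auto split: split_indicator)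
    also have "\<dots> = ennreal (min (Y \<omega>) B)"
      using nonneg[of \<omega>] \<open>B \<ge> 0\<close> by (auto simp: min_def)
    finally show "(\<integral>\<^sup>+ t. (if 0 \<le> t \<and> t \<le> B \<and> t < Y \<omega> then 1 else 0) \<partial>lborel)
        = ennreal (min (Y \<omega>) B)" .
  qed
  finally have eq: "(\<integral>\<^sup>+ t. ennreal (indicator {0..B} t * \<P>(\<omega> in M. Y \<omega> > t)) \<partial>lborel)
      = (\<integral>\<^sup>+ \<omega>. ennreal (min (Y \<omega>) B) \<partial>M)" .
  \<comment> \<open>Both Bochner integrals are \<open>enn2real\<close> of the same nonnegative
    integral, an identity that asks only for measurability and nonnegativity.\<close>
  have "(LBINT t:{0..B}. \<P>(\<omega> in M. Y \<omega> > t))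
      = enn2real (\<integral>\<^sup>+ t. ennreal (indicator {0..B} t * \<P>(\<omega> in M. Y \<omega> > t)) \<partial>lborel)"
    unfolding set_lebesgue_integral_def real_scaleR_def
    by (rule integral_eq_nn_integral) (use m in auto)
  also have "\<dots> = expectation (\<lambda>\<omega>. min (Y \<omega>) B)"
    unfolding eq by (rule integral_eq_nn_integral[symmetric]) (use nonneg \<open>B \<ge> 0\<close> in auto)
  finally show ?thesis .
qed

lemma trunc_measurable [measurable]: "trunc t \<in> borel_measurable borel"
  unfolding trunc_def by measurable

lemma pos_part_measurable [measurable]: "pos_part \<in> borel_measurable borel"
  unfolding pos_part_def by measurable

lemma abs_trunc: "t \<ge> 0 \<Longrightarrow> \<bar>trunc t x\<bar> = min \<bar>x\<bar> t"
  unfolding trunc_def by (auto simp: min_def max_def abs_if)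

text \<open>The map \<open>x \<mapsto> x powr q\<close> is monotone on nonnegative reals, hence
  commutes with \<open>min\<close>. This brings truncated q-th moments into the form of the layer
  cake formula.\<close>

lemma abs_trunc_powr: "t \<ge> 0 \<Longrightarrow> q \<ge> 0 \<Longrightarrow> \<bar>trunc t x\<bar> powr q = min (\<bar>x\<bar> powr q) (t powr q)"
  by (simp add: abs_trunc min_def powr_mono2) (metis linorder_linear order_antisym powr_mono2 abs_ge_zero)

text \<open>The difference vanishes where \<open>\<bar>f z\<bar> \<le> t\<close> and has modulus
  \<open>\<bar>f z\<bar> - t\<close> elsewhere. The indicator lives on the domain of
  \<open>f\<close> to match the terms of series (b).\<close>

lemma abs_diff_trunc_le:
  "t \<ge> 0 \<Longrightarrow> \<bar>f z - trunc t (f z)\<bar> \<le> \<bar>f z\<bar> * indicator {y. \<bar>f y\<bar> > t} z"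
  unfolding trunc_def by (auto simp: min_def max_def abs_if split: split_indicator)

text \<open>The function \<open>x \<mapsto> pos_part (\<bar>x\<bar> - e)\<close> is 1-Lipschitz, so
  a perturbation \<open>y\<close> costs at most \<open>\<bar>y\<bar>\<close>.\<close>

lemma pos_part_abs_add_le: "pos_part (\<bar>x + y\<bar> - e) \<le> pos_part (\<bar>x\<bar> - e) + \<bar>y\<bar>"
  unfolding pos_part_def by auto

lemma pos_part_diff_le_powr:
  assumes "e > 0" "q \<ge> 1" "y \<ge> 0"
  shows "pos_part (y - e) \<le> e powr (1 - q) * y powr q"
proof (cases "y \<ge> e")
  case True
  have "y = y powr (1 - q) * y powr q"
    using True assms by (simp flip: powr_add)
  \<comment> \<open>The exponent \<open>1 - q\<close> is at most 0, so \<open>powr\<close> is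
    antitone in its base and \<open>e \<le> y\<close> gives the bound.\<close>
  also have "\<dots> \<le> e powr (1 - q) * y powr q"
    using True assms by (intro mult_right_mono powr_mono2') auto
  finally show ?thesis
    using True assms unfolding pos_part_def by simp
qed (simp add: pos_part_def)

text \<open>Estimate for a single row: the centred truncations are measured in the q-th moment, the
  centred remainders in L1. No relation between the variables is assumed; the q-th moment stays
  unevaluated until the moment inequality is applied to it.\<close>

lemma (in prob_space) expectation_pos_part_centered_sum_le:
  fixes X :: "'i \<Rightarrow> 'a \<Rightarrow> real"
  assumes "finite K" and int: "\<And>k. k \<in> K \<Longrightarrow> integrable M (X k)"
    and "b > 0" "\<epsilon> > 0" "q > 1"
  shows "expectation (\<lambda>\<omega>. pos_part (\<bar>\<Sum>k\<in>K. X k \<omega> - expectation (X k)\<bar> / b - \<epsilon>))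
    \<le> \<epsilon> powr (1 - q) * b powr (- q) * expectation (\<lambda>\<omega>.
          \<bar>\<Sum>k\<in>K. trunc b (X k \<omega>) - expectation (\<lambda>\<omega>'. trunc b (X k \<omega>'))\<bar> powr q)
      + 2 * (\<Sum>k\<in>K. expectation (\<lambda>\<omega>. \<bar>X k \<omega>\<bar> * indicator {\<omega>'. \<bar>X k \<omega>'\<bar> > b} \<omega>) / b)"
proof -
  let ?g = "\<lambda>k \<omega>. trunc b (X k \<omega>)"
  let ?h = "\<lambda>k \<omega>. X k \<omega> - trunc b (X k \<omega>)"
  let ?J = "\<lambda>k \<omega>. \<bar>X k \<omega>\<bar> * indicator {\<omega>'. \<bar>X k \<omega>'\<bar> > b} \<omega>"
  define S where "S \<omega> = (\<Sum>k\<in>K. ?g k \<omega> - expectation (?g k))" for \<omega>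
  define T where "T \<omega> = (\<Sum>k\<in>K. ?h k \<omega> - expectation (?h k))" for \<omega>
  have rv [measurable]: "X k \<in> borel_measurable M" if "k \<in> K" for k
    using int[OF that] by auto
  have g_int: "integrable M (?g k)" if "k \<in> K" for k
    using that \<open>b > 0\<close> by (intro integrable_const_bound[of _ b]) (auto simp: abs_trunc)
  have h_int: "integrable M (?h k)" if "k \<in> K" for k
    using that int g_int by auto
  have J_int: "integrable M (?J k)" if "k \<in> K" for k
  proof (rule Bochner_Integration.integrable_bound[OF int[OF that]])
    \<comment> \<open>Written as a Borel function of \<open>X k\<close>, the tail term is visibly
      measurable.\<close>
    have "(\<lambda>\<omega>. \<bar>X k \<omega>\<bar> * indicator {y. \<bar>y\<bar> > b} (X k \<omega>)) \<in> borel_measurable M"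
      using rv[OF that] by measurable
    then show "?J k \<in> borel_measurable M"
      by (simp add: indicator_def)
  qed (auto split: split_indicator)
  have [measurable]: "S \<in> borel_measurable M" "T \<in> borel_measurable M"
    unfolding S_def T_def by (auto intro!: borel_measurable_sum)
  \<comment> \<open>A uniform bound on \<open>S\<close> makes its q-th moment finite, although each
    \<open>X k\<close> is only assumed integrable.\<close>
  have S_bound: "\<bar>S \<omega>\<bar> \<le> (\<Sum>k\<in>K. b + \<bar>expectation (?g k)\<bar>)" for \<omega>
  proof -
    have "\<bar>S \<omega>\<bar> \<le> (\<Sum>k\<in>K. \<bar>?g k \<omega> - expectation (?g k)\<bar>)"
      unfolding S_def by (rule sum_abs)
    also have "\<dots> \<le> (\<Sum>k\<in>K. b + \<bar>expectation (?g k)\<bar>)"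
    proof (rule sum_mono)
      fix k
      have "\<bar>?g k \<omega>\<bar> \<le> b"
        using \<open>b > 0\<close> by (simp add: abs_trunc)
      then show "\<bar>?g k \<omega> - expectation (?g k)\<bar> \<le> b + \<bar>expectation (?g k)\<bar>"
        by linarith
    qed
    finally show ?thesis .
  qed
  have S_int: "integrable M (\<lambda>\<omega>. \<bar>S \<omega>\<bar> powr q)"
    using S_bound \<open>q > 1\<close>
    by (intro integrable_const_bound[of _ "(\<Sum>k\<in>K. b + \<bar>expectation (?g k)\<bar>) powr q"])
      (auto intro!: powr_mono2)
  have T_int: "integrable M T"
    unfolding T_def using h_int by (intro Bochner_Integration.integrable_sum) auto
  have split: "(\<Sum>k\<in>K. X k \<omega> - expectation (X k)) = S \<omega> + T \<omega>" for \<omega>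
  proof -
    \<comment> \<open>Centring is linear, so the centred parts add up exactly to the centred
      variable.\<close>
    have "expectation (?h k) = expectation (X k) - expectation (?g k)" if "k \<in> K" for k
      using that int g_int by simp
    then show ?thesis
      unfolding S_def T_def by (simp flip: sum.distrib)
  qed
  have pw: "pos_part (\<bar>S \<omega> + T \<omega>\<bar> / b - \<epsilon>)
      \<le> \<epsilon> powr (1 - q) * b powr (- q) * \<bar>S \<omega>\<bar> powr q + \<bar>T \<omega>\<bar> / b" for \<omega>
  proof -
    \<comment> \<open>\<open>T\<close> is split off before powers are taken, since only its first
      moment is under control.\<close>
    have "pos_part (\<bar>S \<omega> + T \<omega>\<bar> / b - \<epsilon>) \<le> pos_part (\<bar>S \<omega>\<bar> / b - \<epsilon>) + \<bar>T \<omega>\<bar> / b"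
      using pos_part_abs_add_le[of "S \<omega> / b" "T \<omega> / b" \<epsilon>] \<open>b > 0\<close>
      by (simp flip: add_divide_distrib)
    also have "pos_part (\<bar>S \<omega>\<bar> / b - \<epsilon>) \<le> \<epsilon> powr (1 - q) * (\<bar>S \<omega>\<bar> / b) powr q"
      using \<open>\<epsilon> > 0\<close> \<open>q > 1\<close> \<open>b > 0\<close> by (intro pos_part_diff_le_powr) auto
    also have "(\<bar>S \<omega>\<bar> / b) powr q = b powr (- q) * \<bar>S \<omega>\<bar> powr q"
      using \<open>b > 0\<close> by (simp add: powr_divide powr_minus_divide)
    finally show ?thesis
      by (simp add: mult.assoc)
  qed
  \<comment> \<open>The factor 2 is the price of centring: both \<open>?h k\<close> and its mean
    contribute at most \<open>expectation (?J k)\<close>.\<close>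
  have "expectation (\<lambda>\<omega>. \<bar>T \<omega>\<bar>) \<le> 2 * (\<Sum>k\<in>K. expectation (?J k))"
  proof -
    have hJ: "expectation (\<lambda>\<omega>. \<bar>?h k \<omega>\<bar>) \<le> expectation (?J k)" if "k \<in> K" for k
      using h_int[OF that] J_int[OF that] \<open>b > 0\<close>
      by (intro integral_mono abs_diff_trunc_le) auto
    have "expectation (\<lambda>\<omega>. \<bar>T \<omega>\<bar>)
        \<le> expectation (\<lambda>\<omega>. \<Sum>k\<in>K. \<bar>?h k \<omega>\<bar> + \<bar>expectation (?h k)\<bar>)"
    proof (intro integral_mono)
      show "\<bar>T \<omega>\<bar> \<le> (\<Sum>k\<in>K. \<bar>?h k \<omega>\<bar> + \<bar>expectation (?h k)\<bar>)" for \<omega>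
        unfolding T_def by (rule order.trans[OF sum_abs]) (intro sum_mono abs_triangle_ineq4)
    qed (use T_int h_int in \<open>auto intro!: Bochner_Integration.integrable_sum
        Bochner_Integration.integrable_add integrable_abs\<close>)
    also have "\<dots> = (\<Sum>k\<in>K. expectation (\<lambda>\<omega>. \<bar>?h k \<omega>\<bar> + \<bar>expectation (?h k)\<bar>))"
      using h_int by (intro Bochner_Integration.integral_sum
          Bochner_Integration.integrable_add integrable_abs) auto
    also have "\<dots> \<le> (\<Sum>k\<in>K. 2 * expectation (?J k))"
    proof (rule sum_mono)
      fix k assume k: "k \<in> K"
      have "expectation (\<lambda>\<omega>. \<bar>?h k \<omega>\<bar> + \<bar>expectation (?h k)\<bar>)
          = expectation (\<lambda>\<omega>. \<bar>?h k \<omega>\<bar>) + \<bar>expectation (?h k)\<bar>"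
        using integrable_abs[OF h_int[OF k]] by (subst Bochner_Integration.integral_add) (auto simp: prob_space)
      also have "\<dots> \<le> 2 * expectation (?J k)"
        using hJ[OF k] integral_abs_bound[of M "?h k"] by linarith
      finally show "expectation (\<lambda>\<omega>. \<bar>?h k \<omega>\<bar> + \<bar>expectation (?h k)\<bar>) \<le> 2 * expectation (?J k)" .
    qed
    finally show ?thesis
      by (simp add: sum_distrib_left)
  qed
  then have T_le: "expectation (\<lambda>\<omega>. \<bar>T \<omega>\<bar>) / b \<le> 2 * (\<Sum>k\<in>K. expectation (?J k) / b)"
    using \<open>b > 0\<close> by (simp add: divide_right_mono flip: sum_divide_distrib)
  have R_int: "integrable M (\<lambda>\<omega>. \<epsilon> powr (1 - q) * b powr (- q) * \<bar>S \<omega>\<bar> powr q + \<bar>T \<omega>\<bar> / b)"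
    using S_int T_int by auto
  have "expectation (\<lambda>\<omega>. pos_part (\<bar>S \<omega> + T \<omega>\<bar> / b - \<epsilon>))
      \<le> expectation (\<lambda>\<omega>. \<epsilon> powr (1 - q) * b powr (- q) * \<bar>S \<omega>\<bar> powr q + \<bar>T \<omega>\<bar> / b)"
  proof (rule integral_mono[OF _ R_int])
    show "integrable M (\<lambda>\<omega>. pos_part (\<bar>S \<omega> + T \<omega>\<bar> / b - \<epsilon>))"
    \<comment> \<open>The bound \<open>pw\<close> dominates a nonnegative function, so it also holds
      between norms and yields integrability.\<close>
    proof (rule Bochner_Integration.integrable_bound[OF R_int])
      show "AE \<omega> in M. norm (pos_part (\<bar>S \<omega> + T \<omega>\<bar> / b - \<epsilon>))
          \<le> norm (\<epsilon> powr (1 - q) * b powr (- q) * \<bar>S \<omega>\<bar> powr q + \<bar>T \<omega>\<bar> / b)"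
        using pw by (intro AE_I2) (smt (verit) pos_part_def real_norm_def)
    qed measurable
  qed (rule pw)
  also have "\<dots> = \<epsilon> powr (1 - q) * b powr (- q) * expectation (\<lambda>\<omega>. \<bar>S \<omega>\<bar> powr q)
      + expectation (\<lambda>\<omega>. \<bar>T \<omega>\<bar>) / b"
    using S_int T_int by simp
  finally show ?thesis
    using T_le unfolding split by (simp add: S_def)
qed

theorem theorem2p2:
  fixes M :: "'a measure"
    and X :: "nat \<Rightarrow> nat \<Rightarrow> 'a \<Rightarrow> real"
    and q :: real
    and \<alpha> b c :: "nat \<Rightarrow> real"
  assumes "prob_space M"
    and rv: "\<And>n k. 1 \<le> k \<Longrightarrow> k \<le> n \<Longrightarrow> X n k \<in> borel_measurable M"
    and int: "\<And>n k. 1 \<le> k \<Longrightarrow> k \<le> n \<Longrightarrow> integrable M (\<lambda>\<omega>. \<bar>X n k \<omega>\<bar>)"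
    and q: "q > 1"
    and \<alpha>_pos: "\<And>n. n \<ge> 1 \<Longrightarrow> \<alpha> n > 0"
    and moment: "\<And>n t. n \<ge> 1 \<Longrightarrow> t > 0 \<Longrightarrow>
      (\<integral>\<omega>. \<bar>\<Sum>k=1..n. trunc t (X n k \<omega>) - (\<integral>\<omega>'. trunc t (X n k \<omega>') \<partial>M)\<bar> powr q \<partial>M)
        \<le> \<alpha> n * (\<Sum>k=1..n. \<integral>\<omega>. \<bar>trunc t (X n k \<omega>)\<bar> powr q \<partial>M)"
    and b_pos: "\<And>n. n \<ge> 1 \<Longrightarrow> b n > 0"
    and c_pos: "\<And>n. n \<ge> 1 \<Longrightarrow> c n > 0"
    and a: "summable (\<lambda>n. \<Sum>k=1..n. \<alpha> n * c n * b n powr (- q) *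
      (LBINT t:{0..b n powr q}. \<P>(\<omega> in M. \<bar>X n k \<omega>\<bar> powr q > t)))"
    and b: "summable (\<lambda>n. \<Sum>k=1..n. c n *
      (\<integral>\<omega>. \<bar>X n k \<omega>\<bar> * indicator {\<omega>'. \<bar>X n k \<omega>'\<bar> > b n} \<omega> \<partial>M) / b n)"
    and c: "summable (\<lambda>n. \<Sum>k=1..n. (\<alpha> n * c n / b n) *
      (LBINT t:{b n..}. \<P>(\<omega> in M. \<bar>X n k \<omega>\<bar> > t)))"
  shows "\<forall>\<epsilon>>0. summable (\<lambda>n. c n *
      (\<integral>\<omega>. pos_part (\<bar>\<Sum>k=1..n. X n k \<omega> - (\<integral>\<omega>'. X n k \<omega>' \<partial>M)\<bar> / b n - \<epsilon>) \<partial>M))"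
proof (intro allI impI)
  fix \<epsilon> :: real
  assume "\<epsilon> > 0"
  interpret prob_space M by fact
  define A where "A n = (\<Sum>k=1..n. \<alpha> n * c n * b n powr (- q) *
      (LBINT t:{0..b n powr q}. \<P>(\<omega> in M. \<bar>X n k \<omega>\<bar> powr q > t)))" for n
  define B where "B n = (\<Sum>k=1..n. c n *
      (\<integral>\<omega>. \<bar>X n k \<omega>\<bar> * indicator {\<omega>'. \<bar>X n k \<omega>'\<bar> > b n} \<omega> \<partial>M) / b n)" for n
  define L where "L n = (\<integral>\<omega>. pos_part (\<bar>\<Sum>k=1..n. X n k \<omega> - (\<integral>\<omega>'. X n k \<omega>' \<partial>M)\<bar> / b n - \<epsilon>) \<partial>M)" for n
  have L_nonneg: "L n \<ge> 0" for n
    unfolding L_def by (intro integral_nonneg_AE) (simp add: pos_part_def)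
  \<comment> \<open>The row estimate is weighted by \<open>c n\<close>. Only
    \<open>n \<ge> 1\<close> is covered, because positivity of \<open>b\<close> and \<open>c\<close>
    and the moment inequality are given from there on.\<close>
  have bound: "c n * L n \<le> \<epsilon> powr (1 - q) * A n + 2 * B n" if n: "n \<ge> 1" for n
  proof -
    let ?C = "expectation (\<lambda>\<omega>. \<bar>\<Sum>k=1..n. trunc (b n) (X n k \<omega>)
        - (\<integral>\<omega>'. trunc (b n) (X n k \<omega>') \<partial>M)\<bar> powr q)"
    let ?B = "\<Sum>k=1..n. (\<integral>\<omega>. \<bar>X n k \<omega>\<bar> * indicator {\<omega>'. \<bar>X n k \<omega>'\<bar> > b n} \<omega> \<partial>M) / b n"
    have pos: "b n > 0" "c n > 0"
      using n b_pos c_pos by auto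
    have X_int: "integrable M (X n k)" if "k \<in> {1..n}" for k
      using that int[of k n] rv[of k n] integrable_abs_cancel by auto
    have "L n \<le> \<epsilon> powr (1 - q) * b n powr (- q) * ?C + 2 * ?B"
      unfolding L_def using X_int pos \<open>\<epsilon> > 0\<close> q
      by (intro expectation_pos_part_centered_sum_le) auto
    also have "?C \<le> \<alpha> n * (\<Sum>k=1..n. \<integral>\<omega>. \<bar>trunc (b n) (X n k \<omega>)\<bar> powr q \<partial>M)"
      using moment n pos by auto
    also have "(\<Sum>k=1..n. \<integral>\<omega>. \<bar>trunc (b n) (X n k \<omega>)\<bar> powr q \<partial>M)
        = (\<Sum>k=1..n. LBINT t:{0..b n powr q}. \<P>(\<omega> in M. \<bar>X n k \<omega>\<bar> powr q > t))"
    proof (rule sum.cong[OF refl])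
      fix k assume "k \<in> {1..n}"
      then have [measurable]: "X n k \<in> borel_measurable M"
        using rv by simp
      \<comment> \<open>The layer cake formula is used with
        \<open>Y = \<bar>X n k\<bar> powr q\<close> and cut-off \<open>b n powr q\<close>, the image
        of the truncation level.\<close>
      show "(\<integral>\<omega>. \<bar>trunc (b n) (X n k \<omega>)\<bar> powr q \<partial>M)
          = (LBINT t:{0..b n powr q}. \<P>(\<omega> in M. \<bar>X n k \<omega>\<bar> powr q > t))"
        using pos q by (subst expectation_min_eq_integral_tail) (auto simp: abs_trunc_powr)
    qed
    finally have "c n * L n \<le> c n * (\<epsilon> powr (1 - q) * b n powr (- q) * (\<alpha> n *
        (\<Sum>k=1..n. LBINT t:{0..b n powr q}. \<P>(\<omega> in M. \<bar>X n k \<omega>\<bar> powr q > t))) + 2 * ?B)"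
      using pos by (simp add: mult_left_mono)
    \<comment> \<open>Distributing \<open>c n\<close> over the sums recreates the weights
      \<open>\<alpha> n * c n * b n powr (- q)\<close> of (a) and \<open>c n / b n\<close> of
      (b).\<close>
    also have "\<dots> = \<epsilon> powr (1 - q) * A n + 2 * B n"
      unfolding A_def B_def by (simp add: algebra_simps sum_distrib_left)
    finally show ?thesis .
  qed
  have "summable (\<lambda>n. \<epsilon> powr (1 - q) * A n + 2 * B n)"
    using a b unfolding A_def B_def by (intro summable_add summable_mult)
  then have "summable (\<lambda>n. c n * L n)"
  proof (rule summable_comparison_test_ev[rotated])
    \<comment> \<open>Eventual comparison skips the index 0, which lies outside the series of the
      statement; from 1 on the terms are nonnegative and the norm drops out.\<close>
    show "\<forall>\<^sub>F n in sequentially. norm (c n * L n) \<le> \<epsilon> powr (1 - q) * A n + 2 * B n"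
      using eventually_ge_at_top[of 1]
      by eventually_elim (use bound L_nonneg c_pos in \<open>simp add: abs_mult order.strict_implies_order\<close>)
  qed
  then show "summable (\<lambda>n. c n *
      (\<integral>\<omega>. pos_part (\<bar>\<Sum>k=1..n. X n k \<omega> - (\<integral>\<omega>'. X n k \<omega>' \<partial>M)\<bar> / b n - \<epsilon>) \<partial>M))"
    unfolding L_def .
qed

end
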